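(* There is a constant $c$ such that for every integer $t\geq 2$ there exists a finite graph $G$ with average degree at least $t^3$ such that $G$ has no $C_4$-free subgraph with average degree at least $c\,t\log t$.
   Context: All graphs are finite and simple. The average degree of a graph $G$ is $d(G)=2e(G)/|V(G)|$. A graph is $C_4$-free if it contains no cycle of length $4$ as a (not necessarily induced) subgraph. Subgraphs need not be induced. *)

theory Defs
  imports Complex_Main
begin

definition simple_graph :: "'a set \<Rightarrow> 'a set set \<Rightarrow> bool" where
  "simple_graph V E \<longleftrightarrow> finite V \<and>
     E \<subseteq> {{u, v} | u v. u \<in> V \<and> v \<in> V \<and> u \<noteq> v}"

definition avg_degree :: "'a set \<Rightarrow> 'a set set \<Rightarrow> real" where
  "avg_degree V E = 2 * real (card E) / real (card V)"

definition subgraph :: "'a set \<Rightarrow> 'a set set \<Rightarrow> 'a set \<Rightarrow> 'a set set \<Rightarrow> bool" where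
  "subgraph V' E' V E \<longleftrightarrow> simple_graph V' E' \<and> V' \<subseteq> V \<and> E' \<subseteq> E"

definition has_C4 :: "'a set \<Rightarrow> 'a set set \<Rightarrow> bool" where
  "has_C4 V E \<longleftrightarrow> (\<exists>a b c d. a \<in> V \<and> b \<in> V \<and> c \<in> V \<and> d \<in> V \<and>
      distinct [a, b, c, d] \<and>
      {a, b} \<in> E \<and> {b, c} \<in> E \<and> {c, d} \<in> E \<and> {d, a} \<in> E)"

definition C4_free :: "'a set \<Rightarrow> 'a set set \<Rightarrow> bool" where
  "C4_free V E \<longleftrightarrow> \<not> has_C4 V E"

end

theory Submission
  imports Defs "HOL-Library.FuncSet" "HOL-Library.Countable"
begin

text \<open>
  Take a set \<open>B\<close> of size \<open>M\<close> and \<open>K = 2 ^ k\<close> partitions of it, with \<open>t \<le> K \<le> 2 t\<close>, and join every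
  class of every partition completely to \<open>t\<^sup>2\<close> private vertices; the degrees in \<open>B\<close> are then at
  least \<open>t\<^sup>3\<close>. Inside one partition, where the graph is a disjoint union of complete bipartite graphs,
  a \<open>C\<^sub>4\<close>-free subgraph can be dense only on classes of medium size: a class with at least \<open>t\<^sup>4\<close>
  vertices in the subgraph gives two edges per vertex, and a class with \<open>O(k)\<close> vertices gives \<open>O(k)\<close>
  edges per vertex besides the edges charged to the private vertices. On a medium class there are about
  \<open>t\<close> edges per vertex, so all comes down to a vertex lying in \<open>O(k)\<close> medium classes on average.

  The partitions are chosen at random, with class sizes growing doubly exponentially. A union bound shows
  that vertices which share classes of levels below \<open>l\<close> with one another must be far more than the number
  of classes of level \<open>l\<close>; hence they cannot also lie in medium classes of levels \<open>\<ge> l\<close>. Splitting the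
  levels recursively in halves turns this into the bound \<open>O(k) = O(log t)\<close>.
\<close>

section \<open>Random partitions\<close>

text \<open>Each factor of \<open>(m + 1) * ... * (2 * m)\<close> is at least \<open>m\<close>, and
  this product is the central binomial coefficient times \<open>fact m\<close>.\<close>

lemma self_power_le_fact: "m ^ m \<le> 4 ^ m * (fact m :: nat)"
proof -
  have "m ^ m \<le> (\<Prod>i<m. m + Suc i)"
    using prod_mono[of "{..<m}" "\<lambda>_. m" "\<lambda>i. m + Suc i"] by simp
  also have "\<dots> = fact (2 * m) div fact m"
  proof -
    have "fact m * (\<Prod>i<n. m + Suc i) = (fact (m + n) :: nat)" for n
      by (induction n) (simp_all add: algebra_simps)
    from this[of m] show ?thesis
      by (metis fact_nonzero mult_2 nonzero_mult_div_cancel_left)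
  qed
  also have "\<dots> = (2 * m choose m) * fact m"
    by (metis binomial_fact_lemma le_add1 mult_2 diff_add_inverse fact_nonzero nonzero_mult_div_cancel_left mult.assoc mult.commute)
  also have "\<dots> \<le> 2 ^ (2 * m) * fact m"
    by (intro mult_right_mono binomial_le_pow2) auto
  finally show ?thesis by (simp add: power_mult)
qed

text \<open>Trading \<open>m ^ m\<close> for \<open>4 ^ m * fact m\<close> turns the binomial
  coefficient into a falling factorial, which is at most \<open>M ^ m\<close>. In the union bound
  this removes one of the powers of \<open>m\<close>.\<close>

lemma binomial_times_self_power_le: "(M choose m) * m ^ m \<le> (4 * M) ^ m"
proof (cases "m \<le> M")
  case True
  have "(M choose m) * m ^ m \<le> (M choose m) * (4 ^ m * fact m)"
    by (intro mult_left_mono self_power_le_fact) auto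
  also have "\<dots> = 4 ^ m * (fact m * (M choose m))" by simp
  also have "\<dots> \<le> 4 ^ m * M ^ m"
  proof -
    have "fact M = fact (M - m) * \<Prod>{M - m + 1..M}"
      using prod.ub_add_nat[of 1 "M - m" "\<lambda>i. i" m] True by (simp add: fact_prod)
    then have "fact (M - m) * (fact m * (M choose m)) = fact (M - m) * \<Prod>{M - m + 1..M}"
      using True binomial_fact_lemma[of m M] by (simp add: algebra_simps)
    then have "fact m * (M choose m) = \<Prod>{M - m + 1..M}" by simp
    also have "\<dots> \<le> (\<Prod>i\<in>{M - m + 1..M}. M)" by (intro prod_mono) auto
    also have "\<dots> = M ^ m" using True by simp
    finally show ?thesis by simp
  qed
  finally show ?thesis by (simp add: power_mult_distrib)
qed (simp add: binomial_eq_0)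

text \<open>Since \<open>g\<close> leads out of \<open>Y\<close>, a constrained function is
  determined by its restriction to \<open>W - Y\<close>. In terms of probability, each forced value
  at \<open>y\<close> costs a factor \<open>1 / card (A y)\<close>.\<close>

lemma card_PiE_constrained_le:
  assumes "finite W" "Y \<subseteq> W" "\<And>w. w \<in> W \<Longrightarrow> finite (A w)"
    and g: "\<And>y. y \<in> Y \<Longrightarrow> g y \<in> W - Y"
  shows "card {f \<in> PiE W A. \<forall>y\<in>Y. f y = f (g y)} * (\<Prod>y\<in>Y. card (A y)) \<le> card (PiE W A)"
proof -
  let ?F = "{f \<in> PiE W A. \<forall>y\<in>Y. f y = f (g y)}"
  have "inj_on (\<lambda>f. restrict f (W - Y)) ?F"
  proof (rule inj_onI)
    fix f f' assume f: "f \<in> ?F" "f' \<in> ?F" and eq: "restrict f (W - Y) = restrict f' (W - Y)"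
    have out: "f w = f' w" if "w \<in> W - Y" for w
      using fun_cong[OF eq, of w] that by simp
    have "f w = f' w" if "w \<in> W" for w
    proof (cases "w \<in> Y")
      case True
      then show ?thesis using f out[OF g[OF True]] by auto
    qed (use out that in auto)
    then show "f = f'" using f by (intro PiE_ext[of f W A f']) auto
  qed
  moreover have "(\<lambda>f. restrict f (W - Y)) ` ?F \<subseteq> PiE (W - Y) A" by (auto simp: PiE_iff split: if_splits)
  moreover have "finite (PiE (W - Y) A)" using assms by (intro finite_PiE) auto
  ultimately have "card ?F \<le> card (PiE (W - Y) A)" by (rule card_inj_on_le)
  then have "card ?F * (\<Prod>y\<in>Y. card (A y)) \<le> (\<Prod>w\<in>W - Y. card (A w)) * (\<Prod>y\<in>Y. card (A y))"
    using assms by (intro mult_right_mono) (auto simp: card_PiE)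
  also have "\<dots> = card (PiE W A)"
    using assms by (simp add: card_PiE prod.subset_diff[OF assms(2,1)])
  finally show ?thesis .
qed

section \<open>Collision patterns and the union bound\<close>

text \<open>A pair \<open>(b, i)\<close> stands for the incidence of vertex \<open>b\<close> with
  its class \<open>h (b, i)\<close> in partition \<open>i\<close>; the same class number at
  different levels means different classes.\<close>

definition repeats :: "('b \<times> 'i \<Rightarrow> 'c) \<Rightarrow> ('b \<times> 'i) set \<Rightarrow> bool" where
  "repeats h X \<longleftrightarrow> (\<forall>(b, i)\<in>X. \<exists>b'. b' \<noteq> b \<and> (b', i) \<in> X \<and> h (b', i) = h (b, i))"

text \<open>Take the least vertex of each class met by \<open>X\<close> as its representative. Every
  class has a second member, so at least half of \<open>X\<close> consists of non-representatives,
  whose values are forced by representatives outside \<open>Y\<close>. Four pairs per vertex thus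
  leave two forced values per vertex on average.\<close>

lemma collision_witness:
  fixes X :: "(nat \<times> 'i) set"
  assumes fin: "finite X" and rep: "repeats h X"
    and four: "\<And>b. b \<in> fst ` X \<Longrightarrow> 4 \<le> card {i. (b, i) \<in> X}"
  obtains Y r where "Y \<subseteq> X" "card Y = 2 * card (fst ` X)"
    "\<forall>(b, i)\<in>Y. (r (b, i), i) \<in> X - Y \<and> h (r (b, i), i) = h (b, i)"
proof -
  define C where "C = (\<lambda>(b, i). {b'. (b', i) \<in> X \<and> h (b', i) = h (b, i)})"
  define r where "r = (\<lambda>x. Min (C x))"
  have finC: "finite (C x)" for x
  proof (rule finite_subset)
    show "C x \<subseteq> fst ` X" by (cases x) (force simp: C_def)
  qed (use fin in auto)
  have rC: "r x \<in> C x" if "x \<in> X" for x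
    unfolding r_def using that finC by (intro Min_in) (auto simp: C_def)
  have C_eq: "C (b, i) = C (b', i)" if "b' \<in> C (b, i)" for b b' i
    using that by (auto simp: C_def)
  have r_eq: "r (b, i) = r (b', i)" if "b' \<in> C (b, i)" for b b' i
    using C_eq[OF that] by (simp add: r_def)
  define Y0 where "Y0 = {(b, i) \<in> X. r (b, i) \<noteq> b}"
  have Y0X: "Y0 \<subseteq> X" by (auto simp: Y0_def)
  then have finY0: "finite Y0" using fin finite_subset by blast
  \<comment> \<open>Sending a representative to another member of its class is injective, because
    that member determines its representative.\<close>
  have "card (X - Y0) \<le> card Y0"
  proof -
    have "\<forall>x\<in>X - Y0. \<exists>b'. (b', snd x) \<in> Y0 \<and> r (b', snd x) = fst x"
    proof
      fix x assume x: "x \<in> X - Y0"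
      obtain b i where [simp]: "x = (b, i)" by force
      obtain b' where b': "b' \<noteq> b" "b' \<in> C (b, i)"
        using rep x by (auto simp: repeats_def C_def)
      then have "r (b', i) = b" using r_eq[OF b'(2)] x by (auto simp: Y0_def)
      with b' show "\<exists>b'. (b', snd x) \<in> Y0 \<and> r (b', snd x) = fst x"
        by (auto simp: Y0_def C_def)
    qed
    then obtain q where q: "\<And>x. x \<in> X - Y0 \<Longrightarrow> (q x, snd x) \<in> Y0 \<and> r (q x, snd x) = fst x"
      by metis
    show ?thesis
    proof (rule card_inj_on_le)
      show "inj_on (\<lambda>x. (q x, snd x)) (X - Y0)"
        by (rule inj_onI) (metis Pair_inject prod_eqI q)
    qed (use q finY0 in auto)
  qed
  moreover have "card X = card Y0 + card (X - Y0)"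
    using fin Y0X by (metis card_Diff_subset card_mono finY0 le_add_diff_inverse)
  moreover have "4 * card (fst ` X) \<le> card X"
  proof -
    have "X = (SIGMA b:fst ` X. {i. (b, i) \<in> X})" by force
    moreover have "finite {i. (b, i) \<in> X}" for b
      by (rule finite_subset[of _ "snd ` X"]) (use fin in force)+
    ultimately have "card X = (\<Sum>b\<in>fst ` X. card {i. (b, i) \<in> X})"
      using fin card_SigmaI[of "fst ` X" "\<lambda>b. {i. (b, i) \<in> X}"] by simp
    with sum_bounded_below[of "fst ` X" 4 "\<lambda>b. card {i. (b, i) \<in> X}"] four
    show ?thesis by simp
  qed
  ultimately have "2 * card (fst ` X) \<le> card Y0" by linarith
  then obtain Y where Y: "Y \<subseteq> Y0" "card Y = 2 * card (fst ` X)"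
    by (metis obtain_subset_with_card_n)
  show thesis
  proof (rule that[of Y r])
    have "(r (b, i), i) \<in> X - Y \<and> h (r (b, i), i) = h (b, i)" if bi: "(b, i) \<in> Y" for b i
    proof -
      from bi have x: "(b, i) \<in> X" using Y Y0X by auto
      have "r (r (b, i), i) = r (b, i)" using r_eq[OF rC[OF x]] by simp
      then have "(r (b, i), i) \<notin> Y0" by (auto simp: Y0_def)
      then show ?thesis using rC[OF x] Y by (auto simp: C_def)
    qed
    then show "\<forall>(b, i)\<in>Y. (r (b, i), i) \<in> X - Y \<and> h (r (b, i), i) = h (b, i)" by blast
  qed (use Y Y0X in auto)
qed

text \<open>Union bound over witnesses. For \<open>m\<close> vertices below level \<open>l\<close>,
  each witness holds for at most a fraction \<open>1 / n l ^ (2 * m)\<close> of all maps. The two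
  forced values per vertex supply the square in \<open>small\<close>, which has to beat one factor
  \<open>M\<close> for choosing the vertex and one factor \<open>m\<close>, at most
  \<open>\<mu> l\<close>, for choosing representatives.\<close>

lemma exists_sparse_map:
  fixes M K :: nat and N n \<mu> :: "nat \<Rightarrow> nat"
  assumes K: "0 < K" and n_le: "\<And>l i. i < l \<Longrightarrow> l < K \<Longrightarrow> n l \<le> N i" and n_pos: "\<And>l. 0 < n l"
    and N_pos: "\<And>i. 0 < N i"
    and small: "\<And>l. l < K \<Longrightarrow> 16 * K * 2 ^ K * M * \<mu> l \<le> (n l)\<^sup>2"
  obtains h where "\<And>b i. b < M \<Longrightarrow> i < K \<Longrightarrow> h (b, i) < N i"
    and "\<And>l X. l < K \<Longrightarrow> X \<noteq> {} \<Longrightarrow> X \<subseteq> {..<M} \<times> {..<l} \<Longrightarrow> card (fst ` X) \<le> \<mu> l \<Longrightarrow>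
      repeats h X \<Longrightarrow> \<exists>b\<in>fst ` X. card {i. (b, i) \<in> X} < 4"
proof -
  define W where "W = {..<M} \<times> {..<K}"
  define \<Omega> where "\<Omega> = PiE W (\<lambda>(b, i). {..<N i})"
  have finW: "finite W" by (simp add: W_def)
  have fin\<Omega>: "finite \<Omega>" unfolding \<Omega>_def using finW by (intro finite_PiE) auto
  have "card \<Omega> = (\<Prod>w\<in>W. N (snd w))"
    unfolding \<Omega>_def by (subst card_PiE[OF finW]) (auto intro!: prod.cong)
  then have card\<Omega>: "0 < card \<Omega>" using N_pos by (simp add: prod_pos)
  \<comment> \<open>a witness for a bad map: the vertex set, and for two coordinates per vertex (on average) another
    vertex of the same class, so that the value of the map is forced there\<close>
  define Idx where "Idx = (\<lambda>(l :: nat) m. SIGMA S:{S. S \<subseteq> {..<M} \<and> card S = m}.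
    SIGMA Y:{Y. Y \<subseteq> S \<times> {..<l} \<and> card Y = 2 * m}. PiE Y (\<lambda>_. S))"
  define Ev where "Ev = (\<lambda>(S :: nat set, Y, \<phi>).
    {f \<in> \<Omega>. \<forall>y\<in>Y. (\<phi> y, snd y) \<notin> Y \<and> f y = f (\<phi> y, snd y)})"
  define Bad where "Bad = (\<lambda>l m. \<Union> (Ev ` Idx l m))"
  have finS: "finite S" if "S \<subseteq> {..<M}" for S using that finite_subset by blast
  have finY: "finite Y" if "S \<subseteq> {..<M}" "Y \<subseteq> S \<times> {..<l}" for S Y and l :: nat
    using finite_subset[OF that(2)] finS[OF that(1)] by simp
  have finYs: "finite {Y. Y \<subseteq> S \<times> {..<l} \<and> card Y = q}" if "S \<subseteq> {..<M}" for S q and l :: nat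
    by (rule finite_subset[of _ "Pow (S \<times> {..<l})"]) (use finS[OF that] in auto)
  have finInner: "finite (SIGMA Y:{Y. Y \<subseteq> S \<times> {..<l} \<and> card Y = q}. PiE Y (\<lambda>_. S))"
    if "S \<subseteq> {..<M}" for S q and l :: nat
  proof (rule finite_SigmaI[OF finYs[OF that]])
    fix Y assume "Y \<in> {Y. Y \<subseteq> S \<times> {..<l} \<and> card Y = q}"
    then show "finite (PiE Y (\<lambda>_. S))"
      using finY[OF that, of Y l] finS[OF that] by (intro finite_PiE) auto
  qed
  have finIdx: "finite (Idx l m)" for l m
    unfolding Idx_def by (rule finite_SigmaI) (simp_all add: finInner)
  \<comment> \<open>The three factors count the vertex sets \<open>S\<close>, the sets
    \<open>Y\<close> of forced pairs (crudely, all subsets of \<open>S \<times> {..<l}\<close>), and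
    the maps \<open>\<phi>\<close> from the \<open>2 * m\<close> forced pairs to
    \<open>S\<close>.\<close>
  have cardIdx: "card (Idx l m) \<le> (M choose m) * (2 ^ (K * m) * m ^ (2 * m))" if "l < K" for l m
  proof -
    have inner: "card (SIGMA Y:{Y. Y \<subseteq> S \<times> {..<l} \<and> card Y = 2 * m}. PiE Y (\<lambda>_. S))
        \<le> 2 ^ (K * m) * m ^ (2 * m)" if S: "S \<subseteq> {..<M}" "card S = m" for S
    proof -
      let ?\<Y> = "{Y. Y \<subseteq> S \<times> {..<l} \<and> card Y = 2 * m}"
      have fS: "finite (S \<times> {..<l})" using finS S by simp
      have f\<Y>: "finite ?\<Y>" using fS by auto
      have fPiE: "finite (PiE Y (\<lambda>_. S))" "card (PiE Y (\<lambda>_. S)) = m ^ (2 * m)" if "Y \<in> ?\<Y>" for Y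
      proof -
        have Y: "finite Y" "card Y = 2 * m" using finite_subset[OF _ fS, of Y] that by auto
        show "finite (PiE Y (\<lambda>_. S))" using Y(1) finS[OF S(1)] by (intro finite_PiE)
        show "card (PiE Y (\<lambda>_. S)) = m ^ (2 * m)" using Y S(2) by (simp add: card_PiE)
      qed
      have "card (SIGMA Y:?\<Y>. PiE Y (\<lambda>_. S)) = (\<Sum>Y\<in>?\<Y>. card (PiE Y (\<lambda>_. S)))"
        by (rule card_SigmaI[OF f\<Y>]) (simp add: fPiE)
      also have "\<dots> = (\<Sum>Y\<in>?\<Y>. m ^ (2 * m))"
        by (intro sum.cong refl fPiE)
      also have "\<dots> = card ?\<Y> * m ^ (2 * m)" by simp
      also have "card ?\<Y> \<le> card (Pow (S \<times> {..<l}))" using fS by (intro card_mono) auto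
      also have "\<dots> = 2 ^ (m * l)" using fS S by (simp add: card_Pow card_cartesian_product)
      also have "\<dots> \<le> 2 ^ (K * m)" using \<open>l < K\<close> by (intro power_increasing) auto
      finally show ?thesis by simp
    qed
    have f\<S>: "finite {S. S \<subseteq> {..<M} \<and> card S = m}" by simp
    have "card (Idx l m) = (\<Sum>S\<in>{S. S \<subseteq> {..<M} \<and> card S = m}.
        card (SIGMA Y:{Y. Y \<subseteq> S \<times> {..<l} \<and> card Y = 2 * m}. PiE Y (\<lambda>_. S)))"
      unfolding Idx_def by (rule card_SigmaI[OF f\<S>]) (simp add: finInner)
    also have "\<dots> \<le> (\<Sum>S\<in>{S. S \<subseteq> {..<M} \<and> card S = m}. 2 ^ (K * m) * m ^ (2 * m))"
      using inner by (intro sum_mono) auto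
    also have "\<dots> = (M choose m) * (2 ^ (K * m) * m ^ (2 * m))"
      by (simp add: n_subsets)
    finally show ?thesis .
  qed
  have cardEv: "card (Ev I) * n l ^ (2 * m) \<le> card \<Omega>" if I: "I \<in> Idx l m" and l: "l < K" for I l m
  proof -
    obtain S Y \<phi> where I_eq: "I = (S, Y, \<phi>)" by (cases I) auto
    have S: "S \<subseteq> {..<M}" and Y: "Y \<subseteq> S \<times> {..<l}" "card Y = 2 * m" and \<phi>: "\<phi> \<in> PiE Y (\<lambda>_. S)"
      using I by (auto simp: Idx_def I_eq)
    show ?thesis
    proof (cases "\<forall>y\<in>Y. (\<phi> y, snd y) \<notin> Y")
      case False
      then have "Ev I = {}" by (auto simp: Ev_def I_eq)
      then show ?thesis by simp
    next
      case True
      have Ev_eq: "Ev I = {f \<in> \<Omega>. \<forall>y\<in>Y. f y = f (\<phi> y, snd y)}"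
        using True by (auto simp: Ev_def I_eq)
      have YW: "Y \<subseteq> W" using Y S l by (force simp: W_def)
      have gW: "(\<phi> y, snd y) \<in> W - Y" if "y \<in> Y" for y
        using that True \<phi> S Y l by (force simp: W_def PiE_iff)
      have "n l ^ (2 * m) = (\<Prod>y\<in>Y. n l)" using Y by simp
      also have "\<dots> \<le> (\<Prod>y\<in>Y. card (case y of (b, i) \<Rightarrow> {..<N i}))"
        using Y n_le l by (intro prod_mono) force
      finally have "card (Ev I) * n l ^ (2 * m)
          \<le> card (Ev I) * (\<Prod>y\<in>Y. card (case y of (b, i) \<Rightarrow> {..<N i}))" by simp
      also have "\<dots> \<le> card \<Omega>"
        unfolding Ev_eq \<Omega>_def by (rule card_PiE_constrained_le[OF finW YW _ gW]) auto
      finally show ?thesis .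
    qed
  qed
  have cardBad: "card (Bad l m) * (2 * K * 2 ^ m) \<le> card \<Omega>" if l: "l < K" and m: "1 \<le> m" "m \<le> \<mu> l" for l m
  proof -
    have "card (Bad l m) * n l ^ (2 * m) \<le> (\<Sum>I\<in>Idx l m. card (Ev I)) * n l ^ (2 * m)"
      unfolding Bad_def using finIdx by (intro mult_right_mono card_UN_le) auto
    also have "\<dots> = (\<Sum>I\<in>Idx l m. card (Ev I) * n l ^ (2 * m))" by (simp add: sum_distrib_right)
    also have "\<dots> \<le> card (Idx l m) * card \<Omega>"
      using sum_mono[of "Idx l m" "\<lambda>I. card (Ev I) * n l ^ (2 * m)" "\<lambda>_. card \<Omega>"] cardEv l by simp
    also have "card (Idx l m) \<le> (M choose m) * (2 ^ (K * m) * m ^ (2 * m))" by (rule cardIdx[OF l])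
    \<comment> \<open>One \<open>m ^ m\<close> is absorbed together with the binomial coefficient;
      the other stays and is controlled by \<open>m \<le> \<mu> l\<close>.\<close>
    also have "\<dots> = ((M choose m) * m ^ m) * (2 ^ K * m) ^ m"
      by (simp add: power_mult power_mult_distrib mult_2 power_add)
    also have "\<dots> \<le> (4 * M) ^ m * (2 ^ K * m) ^ m"
      by (intro mult_right_mono binomial_times_self_power_le) auto
    also have "\<dots> = (4 * M * 2 ^ K * m) ^ m" by (simp add: power_mult_distrib)
    finally have 1: "card (Bad l m) * n l ^ (2 * m) \<le> (4 * M * 2 ^ K * m) ^ m * card \<Omega>" by simp
    have "(4 * K) * (4 * M * 2 ^ K * m) \<le> 16 * K * 2 ^ K * M * \<mu> l" using m by simp
    also have "\<dots> \<le> (n l)\<^sup>2" by (rule small[OF l])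
    finally have "((4 * K) * (4 * M * 2 ^ K * m)) ^ m \<le> ((n l)\<^sup>2) ^ m" by (rule power_mono) simp
    then have 2: "(4 * K) ^ m * (4 * M * 2 ^ K * m) ^ m \<le> n l ^ (2 * m)"
      unfolding power_mult_distrib[of "4 * K" "4 * M * 2 ^ K * m"] power_mult .
    have "n l ^ (2 * m) * (card (Bad l m) * (4 * K) ^ m)
        \<le> ((4 * M * 2 ^ K * m) ^ m * card \<Omega>) * (4 * K) ^ m"
      using mult_right_mono[OF 1, of "(4 * K) ^ m"] by (simp add: algebra_simps)
    also have "\<dots> \<le> n l ^ (2 * m) * card \<Omega>"
      using mult_right_mono[OF 2, of "card \<Omega>"] by (simp add: algebra_simps)
    finally have 3: "card (Bad l m) * (4 * K) ^ m \<le> card \<Omega>" using n_pos[of l] by simp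
    \<comment> \<open>The fraction of bad maps becomes at most \<open>1 / (2 * K * 2 ^ m)\<close>.
      Summing the geometric series over \<open>m\<close> and then the \<open>K\<close> levels gives
      at most one half.\<close>
    have "2 * K \<le> (2 * K) ^ m" using K m by (intro self_le_power) auto
    then have "2 * K * 2 ^ m \<le> (2 * K) ^ m * 2 ^ m" by simp
    also have "\<dots> = (4 * K) ^ m"
      unfolding power_mult_distrib[symmetric] by (simp add: mult.commute)
    finally have "card (Bad l m) * (2 * K * 2 ^ m) \<le> card (Bad l m) * (4 * K) ^ m" by simp
    with 3 show ?thesis by linarith
  qed
  have geo: "(\<Sum>m=1..q. (1 / 2) ^ m) = 1 - (1 / 2 :: real) ^ q" for q by (induction q) auto
  define B where "B = (\<Union>l<K. \<Union>m\<in>{1..\<mu> l}. Bad l m)"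
  have "real (card B) \<le> (\<Sum>l<K. \<Sum>m=1..\<mu> l. real (card (Bad l m)))"
  proof -
    have "card B \<le> (\<Sum>l<K. card (\<Union>m\<in>{1..\<mu> l}. Bad l m))" unfolding B_def by (rule card_UN_le) simp
    also have "\<dots> \<le> (\<Sum>l<K. \<Sum>m=1..\<mu> l. card (Bad l m))" by (intro sum_mono card_UN_le) simp
    finally show ?thesis by (simp flip: of_nat_sum)
  qed
  also have "\<dots> \<le> (\<Sum>l<K. \<Sum>m=1..\<mu> l. real (card \<Omega>) / (2 * real K) * (1 / 2) ^ m)"
  proof (intro sum_mono)
    fix l m assume "l \<in> {..<K}" "m \<in> {1..\<mu> l}"
    then have "card (Bad l m) * (2 * K * 2 ^ m) \<le> card \<Omega>" using cardBad by auto
    then have "real (card (Bad l m) * (2 * K * 2 ^ m)) \<le> real (card \<Omega>)"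
      by (rule of_nat_mono)
    then show "real (card (Bad l m)) \<le> real (card \<Omega>) / (2 * real K) * (1 / 2) ^ m"
      using K by (simp add: field_simps)
  qed
  also have "\<dots> = (\<Sum>l<K. real (card \<Omega>) / (2 * real K) * (1 - (1 / 2) ^ \<mu> l))"
    by (simp only: sum_distrib_left[symmetric] geo)
  also have "\<dots> \<le> (\<Sum>l<K. real (card \<Omega>) / (2 * real K) * 1)"
    by (intro sum_mono mult_left_mono) auto
  also have "\<dots> = real (card \<Omega>) / 2" using K by simp
  also have "\<dots> < real (card \<Omega>)" using card\<Omega> by simp
  finally have "card B < card \<Omega>" by simp
  moreover have "B \<subseteq> \<Omega>" by (auto simp: B_def Bad_def Ev_def)
  ultimately obtain h where h: "h \<in> \<Omega>" "h \<notin> B" by (metis less_irrefl subsetI subset_antisym)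
  show thesis
  proof (rule that)
    show "h (b, i) < N i" if "b < M" "i < K" for b i
      using h(1) that by (auto simp: \<Omega>_def W_def PiE_iff)
  next
    fix l X assume l: "l < K" and X: "X \<noteq> {}" "X \<subseteq> {..<M} \<times> {..<l}" "card (fst ` X) \<le> \<mu> l" "repeats h X"
    have finX: "finite X" using X(2) finite_subset by blast
    show "\<exists>b\<in>fst ` X. card {i. (b, i) \<in> X} < 4"
    proof (rule ccontr)
      assume "\<not> ?thesis"
      then have "\<And>b. b \<in> fst ` X \<Longrightarrow> 4 \<le> card {i. (b, i) \<in> X}" by auto
      with finX X(4) obtain Y r where Y: "Y \<subseteq> X" "card Y = 2 * card (fst ` X)"
        and r: "\<forall>(b, i)\<in>Y. (r (b, i), i) \<in> X - Y \<and> h (r (b, i), i) = h (b, i)"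
        by (rule collision_witness)
      define m where "m = card (fst ` X)"
      have "(fst ` X, Y, restrict r Y) \<in> Idx l m"
        using X Y r unfolding Idx_def m_def by (force simp: PiE_iff)
      moreover have "h \<in> Ev (fst ` X, Y, restrict r Y)"
        using h(1) r by (auto simp: Ev_def)
      ultimately have "h \<in> Bad l m" unfolding Bad_def by blast
      moreover have "1 \<le> m" using X(1) finX by (simp add: m_def Suc_le_eq card_gt_0_iff)
      ultimately show False using h(2) l X(3) by (auto simp: B_def m_def)
    qed
  qed
qed

section \<open>Medium classes\<close>

text \<open>The level is part of the label, so that classes of different partitions stay distinct
  and disjoint ranges of levels have disjoint label sets.\<close>

definition labels :: "('b \<times> 'i \<Rightarrow> 'c) \<Rightarrow> ('b \<times> 'i) set \<Rightarrow> ('i \<times> 'c) set" where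
  "labels h X = (\<lambda>(b, i). (i, h (b, i))) ` X"

definition multiplicity_le :: "nat \<Rightarrow> ('b \<times> 'i \<Rightarrow> 'c) \<Rightarrow> ('b \<times> 'i) set \<Rightarrow> bool" where
  "multiplicity_le T h X \<longleftrightarrow> (\<forall>(b, i)\<in>X. card {b'. (b', i) \<in> X \<and> h (b', i) = h (b, i)} \<le> T)"

lemma finite_level: "finite X \<Longrightarrow> finite {b. (b, i) \<in> X \<and> P b}"
  by (rule finite_subset[of _ "fst ` X"]) (force, simp)

lemma multiplicity_le_subset:
  assumes "multiplicity_le T h X" "X' \<subseteq> X" "finite X"
  shows "multiplicity_le T h X'"
  unfolding multiplicity_le_def
proof clarify
  fix b i assume "(b, i) \<in> X'"
  then have "card {b'. (b', i) \<in> X \<and> h (b', i) = h (b, i)} \<le> T"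
    using assms by (auto simp: multiplicity_le_def)
  moreover have "card {b'. (b', i) \<in> X' \<and> h (b', i) = h (b, i)} \<le> card {b'. (b', i) \<in> X \<and> h (b', i) = h (b, i)}"
    using assms by (intro card_mono finite_level) auto
  ultimately show "card {b'. (b', i) \<in> X' \<and> h (b', i) = h (b, i)} \<le> T" by linarith
qed

text \<open>\<open>N i\<close> bounds the class numbers of partition \<open>i\<close>. The threshold
  \<open>T * K * N l\<close> bounds how many vertices can occur at levels from \<open>l\<close> on
  when each class contributes at most \<open>T\<close> of them.\<close>

locale sparse_map =
  fixes M K T :: nat and N :: "nat \<Rightarrow> nat" and h :: "nat \<times> nat \<Rightarrow> nat"
  assumes h_less: "b < M \<Longrightarrow> i < K \<Longrightarrow> h (b, i) < N i"
    and N_antimono: "i \<le> j \<Longrightarrow> N j \<le> N i"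
    and sparse: "l < K \<Longrightarrow> X \<noteq> {} \<Longrightarrow> X \<subseteq> {..<M} \<times> {..<l} \<Longrightarrow> card (fst ` X) \<le> T * K * N l \<Longrightarrow>
      repeats h X \<Longrightarrow> \<exists>b\<in>fst ` X. card {i. (b, i) \<in> X} < 4"
begin

text \<open>Every vertex has a pair at one of at most \<open>K\<close> levels from \<open>l\<close>
  on, each with at most \<open>N l\<close> classes of multiplicity at most \<open>T\<close>. Hence
  there are few enough vertices for \<open>sparse\<close> to apply to the pairs below
  \<open>l\<close>; these still repeat, since repetition concerns one level at a time.\<close>

lemma no_split_pattern:
  assumes X: "X \<noteq> {}" "finite X" "X \<subseteq> {..<M} \<times> {..<K}" and l: "l < K"
    and mult: "multiplicity_le T h X" and rep: "repeats h X"
    and low: "\<And>b. b \<in> fst ` X \<Longrightarrow> 4 \<le> card {i. (b, i) \<in> X \<and> i < l}"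
    and high: "\<And>b. b \<in> fst ` X \<Longrightarrow> \<exists>i\<ge>l. (b, i) \<in> X"
  shows False
proof -
  have level: "card {b. (b, r) \<in> X} \<le> T * N r" if r: "r < K" for r
  proof -
    have eq: "{b. (b, r) \<in> X} = (\<Union>p<N r. {b. (b, r) \<in> X \<and> h (b, r) = p})"
      using h_less X(3) r by auto
    have "card {b. (b, r) \<in> X} \<le> (\<Sum>p<N r. card {b. (b, r) \<in> X \<and> h (b, r) = p})"
      unfolding eq by (rule card_UN_le) simp
    also have "\<dots> \<le> (\<Sum>p<N r. T)"
    proof (rule sum_mono)
      fix p
      show "card {b. (b, r) \<in> X \<and> h (b, r) = p} \<le> T"
      proof (cases "\<exists>b. (b, r) \<in> X \<and> h (b, r) = p")
        case True
        then show ?thesis using mult by (auto simp: multiplicity_le_def)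
      next
        case False
        then have "{b. (b, r) \<in> X \<and> h (b, r) = p} = {}" by blast
        then show ?thesis by (metis card.empty le0)
      qed
    qed
    finally show ?thesis by (simp add: mult.commute)
  qed
  have "fst ` X \<subseteq> (\<Union>r\<in>{l..<K}. {b. (b, r) \<in> X})"
  proof
    fix b assume "b \<in> fst ` X"
    then obtain i where "l \<le> i" "(b, i) \<in> X" using high by blast
    moreover from this have "i < K" using X(3) by auto
    ultimately have "i \<in> {l..<K}" "b \<in> {b. (b, i) \<in> X}" by auto
    then show "b \<in> (\<Union>r\<in>{l..<K}. {b. (b, r) \<in> X})" by (rule UN_I)
  qed
  then have "card (fst ` X) \<le> card (\<Union>r\<in>{l..<K}. {b. (b, r) \<in> X})"
    using finite_level[OF X(2), of _ "\<lambda>_. True"] by (intro card_mono) auto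
  also have "\<dots> \<le> (\<Sum>r\<in>{l..<K}. card {b. (b, r) \<in> X})" by (rule card_UN_le) simp
  also have "\<dots> \<le> (\<Sum>r\<in>{l..<K}. T * N l)"
    by (intro sum_mono order.trans[OF level] mult_left_mono N_antimono) auto
  also have "\<dots> = (K - l) * (T * N l)" by simp
  also have "\<dots> \<le> K * (T * N l)" by (intro mult_right_mono) auto
  finally have card_le: "card (fst ` X) \<le> T * K * N l" by (simp add: mult.assoc mult.left_commute)
  define Y where "Y = {(b, i) \<in> X. i < l}"
  have in_Y: "(b, i) \<in> Y \<longleftrightarrow> (b, i) \<in> X \<and> i < l" for b i by (simp add: Y_def)
  have "fst ` X \<subseteq> fst ` Y"
  proof
    fix b assume "b \<in> fst ` X"
    then have "4 \<le> card {i. (b, i) \<in> X \<and> i < l}" by (rule low)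
    then have "{i. (b, i) \<in> X \<and> i < l} \<noteq> {}" by fastforce
    then obtain i where "(b, i) \<in> Y" by (auto simp: in_Y)
    then show "b \<in> fst ` Y" by force
  qed
  then have fst_Y: "fst ` Y = fst ` X" by (auto simp: Y_def)
  have "\<exists>b\<in>fst ` Y. card {i. (b, i) \<in> Y} < 4"
  proof (rule sparse[OF l])
    show "Y \<noteq> {}" using fst_Y X(1) by auto
    show "Y \<subseteq> {..<M} \<times> {..<l}" using X(3) by (auto simp: Y_def)
    show "repeats h Y" using rep by (fastforce simp: repeats_def Y_def)
  qed (simp add: fst_Y card_le)
  then show False using low by (force simp: fst_Y in_Y)
qed

text \<open>Elements with at most three low or with no high coordinates, and labels occurring only once,
  are peeled off greedily; since the pattern above is impossible, nothing remains.\<close>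

lemma split_levels:
  assumes "finite X" "X \<subseteq> {..<M} \<times> {..<K}" and l: "l < K" and "multiplicity_le T h X"
  shows "\<exists>XL XR. XL \<subseteq> {(b, i) \<in> X. i < l} \<and> XR \<subseteq> {(b, i) \<in> X. l \<le> i} \<and> fst ` XL \<inter> fst ` XR = {} \<and>
    card X \<le> card XL + card XR + 3 * card (fst ` X) + card (labels h X)"
  using assms(1,2,4)
proof (induction X rule: finite_psubset_induct)
  case (psubset X)
  note fin = psubset.hyps
  have IH: "\<exists>XL XR. XL \<subseteq> {(b, i) \<in> X'. i < l} \<and> XR \<subseteq> {(b, i) \<in> X'. l \<le> i} \<and> fst ` XL \<inter> fst ` XR = {} \<and>
    card X' \<le> card XL + card XR + 3 * card (fst ` X') + card (labels h X')" if "X' \<subset> X" for X'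
    using psubset.IH[OF that] psubset.prems that fin
    by (meson multiplicity_le_subset order.strict_implies_order order.trans)
  have labels_mono: "card (labels h X') \<le> card (labels h X)" if "X' \<subseteq> X" for X'
    using that fin by (auto simp: labels_def intro!: card_mono)
  consider "X = {}" | (vertex) b where "b \<in> fst ` X"
      "card {i. (b, i) \<in> X \<and> i < l} \<le> 3 \<or> (\<forall>i\<ge>l. (b, i) \<notin> X)"
    | (single) b i where "(b, i) \<in> X" "\<And>b'. (b', i) \<in> X \<Longrightarrow> h (b', i) = h (b, i) \<Longrightarrow> b' = b"
  proof (cases "X = {} \<or> (\<exists>b\<in>fst ` X. card {i. (b, i) \<in> X \<and> i < l} \<le> 3 \<or> (\<forall>i\<ge>l. (b, i) \<notin> X))")
    case False
    have low: "4 \<le> card {i. (b, i) \<in> X \<and> i < l}" if "b \<in> fst ` X" for b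
    proof -
      have "\<not> card {i. (b, i) \<in> X \<and> i < l} \<le> 3" using False that by blast
      then show ?thesis by simp
    qed
    have high: "\<exists>i\<ge>l. (b, i) \<in> X" if "b \<in> fst ` X" for b using False that by blast
    have "X \<noteq> {}" using False by blast
    \<comment> \<open>If no vertex can be peeled off, every vertex has four low pairs and a high
      one. The excluded pattern then leaves only the case that some label occurs once.\<close>
    have "\<not> repeats h X"
      using no_split_pattern[OF \<open>X \<noteq> {}\<close> fin psubset.prems(1) l psubset.prems(2) _ low high] by blast
    then show ?thesis using that(3) by (auto simp: repeats_def)
  qed (use that(1,2) in blast)
  then show ?case
  proof cases
    case 1
    then show ?thesis by auto
  next
    case (vertex b)
    define X' where "X' = X - {b} \<times> UNIV"
    define L where "L = {(b', i) \<in> X. b' = b \<and> i < l}"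
    define R where "R = {(b', i) \<in> X. b' = b \<and> l \<le> i}"
    obtain i0 where "(b, i0) \<in> X" using vertex(1) by auto
    moreover have "(b, i0) \<notin> X'" "X' \<subseteq> X" by (auto simp: X'_def)
    ultimately have sub: "X' \<subset> X" by blast
    have finLR: "finite L" "finite R" "finite X'"
      by (auto intro!: finite_subset[OF _ fin] simp: L_def R_def X'_def)
    have X_eq: "X = X' \<union> (L \<union> R)" by (auto simp: X'_def L_def R_def)
    have "card X = card X' + (card L + card R)"
    proof -
      have "card (L \<union> R) = card L + card R"
        using finLR by (intro card_Un_disjoint) (auto simp: L_def R_def)
      moreover have "card X = card X' + card (L \<union> R)"
        unfolding X_eq by (intro card_Un_disjoint finite_UnI finLR) (auto simp: X'_def L_def R_def)
      ultimately show ?thesis by simp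
    qed
    moreover obtain XL XR where split: "XL \<subseteq> {(b, i) \<in> X'. i < l}" "XR \<subseteq> {(b, i) \<in> X'. l \<le> i}"
      "fst ` XL \<inter> fst ` XR = {}"
      and card': "card X' \<le> card XL + card XR + 3 * card (fst ` X') + card (labels h X')"
      using IH[OF sub] by blast
    moreover have "card (fst ` X') + 1 \<le> card (fst ` X)"
    proof -
      have "b \<notin> fst ` X'" "fst ` X' \<subseteq> fst ` X" by (auto simp: X'_def)
      with vertex(1) have "fst ` X' \<subset> fst ` X" by blast
      then have "card (fst ` X') < card (fst ` X)" using fin by (intro psubset_card_mono) auto
      then show ?thesis by simp
    qed
    moreover have "card (labels h X') \<le> card (labels h X)" using sub by (intro labels_mono) auto
    \<comment> \<open>Dropping \<open>b\<close> lowers the number of vertices by one, and the 3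
      units gained can pay for low pairs of \<open>b\<close>.\<close>
    ultimately have total: "card X + 3 \<le> card XL + card XR + (card L + card R) + 3 * card (fst ` X) + card (labels h X)"
      by linarith
    have notin: "b \<notin> fst ` XL" "b \<notin> fst ` XR" using split by (auto simp: X'_def)
    have fins: "finite XL" "finite XR"
      using split sub by (auto intro!: finite_subset[OF _ fin])
    show ?thesis
    proof (cases "card {i. (b, i) \<in> X \<and> i < l} \<le> 3")
      case True
      \<comment> \<open>The at most three low pairs of \<open>b\<close> are discarded and its high
        pairs join \<open>XR\<close>; in the other case there are no high pairs and the low ones
        join \<open>XL\<close>. Either way \<open>b\<close> occurs on one side only, which keeps the
        vertex sets disjoint.\<close>
      have "L = Pair b ` {i. (b, i) \<in> X \<and> i < l}" by (auto simp: L_def)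
      then have "card L \<le> 3" using True by (simp add: card_image inj_on_def)
      moreover have "card (XR \<union> R) = card XR + card R"
        using fins finLR notin by (intro card_Un_disjoint) (force simp: R_def)+
      ultimately have "card X \<le> card XL + card (XR \<union> R) + 3 * card (fst ` X) + card (labels h X)"
        using total by linarith
      moreover have "XL \<subseteq> {(b, i) \<in> X. i < l}" "XR \<union> R \<subseteq> {(b, i) \<in> X. l \<le> i}"
        using split(1,2) sub by (auto simp: R_def)
      moreover have "fst ` R \<subseteq> {b}" by (auto simp: R_def)
      then have "fst ` XL \<inter> fst ` (XR \<union> R) = {}" using split(3) notin unfolding image_Un by blast
      ultimately show ?thesis by blast
    next
      case False
      then have "R = {}" using vertex(2) by (auto simp: R_def)
      moreover have "card (XL \<union> L) = card XL + card L"
        using fins finLR notin by (intro card_Un_disjoint) (force simp: L_def)+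
      ultimately have "card X \<le> card (XL \<union> L) + card XR + 3 * card (fst ` X) + card (labels h X)"
        using total by simp
      moreover have "XL \<union> L \<subseteq> {(b, i) \<in> X. i < l}" "XR \<subseteq> {(b, i) \<in> X. l \<le> i}"
        using split(1,2) sub by (auto simp: L_def)
      moreover have "fst ` L \<subseteq> {b}" by (auto simp: L_def)
      then have "fst ` (XL \<union> L) \<inter> fst ` XR = {}" using split(3) notin unfolding image_Un by blast
      ultimately show ?thesis by blast
    qed
  next
    case (single b i)
    define X' where "X' = X - {(b, i)}"
    have "(b, i) \<notin> X'" "X' \<subseteq> X" by (auto simp: X'_def)
    with single(1) have sub: "X' \<subset> X" by blast
    have "card X = card X' + 1" using card.remove[OF fin single(1)] by (simp add: X'_def)
    moreover obtain XL XR where split: "XL \<subseteq> {(b, i) \<in> X'. i < l}" "XR \<subseteq> {(b, i) \<in> X'. l \<le> i}"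
      "fst ` XL \<inter> fst ` XR = {}"
      and card': "card X' \<le> card XL + card XR + 3 * card (fst ` X') + card (labels h X')"
      using IH[OF sub] by blast
    \<comment> \<open>The label of the removed pair disappears with it, and this drop pays for the
      pair.\<close>
    moreover have "card (labels h X') < card (labels h X)"
    proof (rule psubset_card_mono)
      have "(i, h (b, i)) \<notin> labels h X'"
      proof
        assume "(i, h (b, i)) \<in> labels h X'"
        then obtain b' where b': "(b', i) \<in> X'" "h (b', i) = h (b, i)" by (auto simp: labels_def)
        then have "b' = b" using sub by (intro single(2)) auto
        with b'(1) \<open>(b, i) \<notin> X'\<close> show False by simp
      qed
      moreover have "(i, h (b, i)) \<in> labels h X" using single(1) unfolding labels_def by (rule image_eqI[rotated]) simp
      moreover have "labels h X' \<subseteq> labels h X" by (auto simp: labels_def X'_def)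
      ultimately show "labels h X' \<subset> labels h X" by blast
    qed (use fin in \<open>simp add: labels_def\<close>)
    moreover have "card (fst ` X') \<le> card (fst ` X)" using fin sub by (intro card_mono) auto
    ultimately have "card X \<le> card XL + card XR + 3 * card (fst ` X) + card (labels h X)" by linarith
    moreover have "XL \<subseteq> {(b, i) \<in> X. i < l}" "XR \<subseteq> {(b, i) \<in> X. l \<le> i}"
      using split(1,2) sub by auto
    ultimately show ?thesis using split(3) by blast
  qed
qed

text \<open>Each halving of the range of levels costs 3 per vertex and 1 per label. The two halves
  have disjoint vertex sets and disjoint label sets, so the cost of one round does not grow with the
  depth. After \<open>j\<close> rounds a single level is left, where a vertex has at most one
  pair.\<close>

lemma card_dyadic_le:
  assumes "finite X" "X \<subseteq> {..<M} \<times> {a..<a + 2 ^ j}" "a + 2 ^ j \<le> K" "multiplicity_le T h X"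
  shows "card X \<le> (3 * j + 1) * card (fst ` X) + j * card (labels h X)"
  using assms
proof (induction j arbitrary: a X)
  case 0
  then have "inj_on fst X" by (auto simp: inj_on_def)
  then show ?case by (simp add: card_image)
next
  case (Suc j)
  have X: "X \<subseteq> {..<M} \<times> {..<K}" and l: "a + 2 ^ j < K"
    using Suc.prems(2,3) by (auto simp: less_le_trans[OF _ Suc.prems(3)])
  obtain XL XR where sub: "XL \<subseteq> {(b, i) \<in> X. i < a + 2 ^ j}" "XR \<subseteq> {(b, i) \<in> X. a + 2 ^ j \<le> i}"
    and disj: "fst ` XL \<inter> fst ` XR = {}"
    and card_X: "card X \<le> card XL + card XR + 3 * card (fst ` X) + card (labels h X)"
    using split_levels[OF Suc.prems(1) X l Suc.prems(4)] by blast
  have subX: "XL \<subseteq> X" "XR \<subseteq> X" using sub by auto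
  then have fin: "finite XL" "finite XR" using Suc.prems(1) finite_subset by blast+
  have "XL \<subseteq> {..<M} \<times> {a..<a + 2 ^ j}" "XR \<subseteq> {..<M} \<times> {a + 2 ^ j..<a + 2 ^ j + 2 ^ j}"
    by (auto dest!: subsetD[OF sub(1)] subsetD[OF sub(2)] dest: subsetD[OF Suc.prems(2)])
  note ranges = this
  have "card XL \<le> (3 * j + 1) * card (fst ` XL) + j * card (labels h XL)"
    by (rule Suc.IH[OF fin(1) ranges(1) _ multiplicity_le_subset[OF Suc.prems(4) subX(1) Suc.prems(1)]]) (use l in simp)
  moreover have "card XR \<le> (3 * j + 1) * card (fst ` XR) + j * card (labels h XR)"
    by (rule Suc.IH[OF fin(2) ranges(2) _ multiplicity_le_subset[OF Suc.prems(4) subX(2) Suc.prems(1)]])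
      (use Suc.prems(3) in simp)
  moreover have "card (fst ` XL) + card (fst ` XR) \<le> card (fst ` X)"
    using disj fin subX Suc.prems(1)
    by (subst card_Un_disjoint[symmetric]) (auto intro!: card_mono)
  then have "(3 * j + 1) * card (fst ` XL) + (3 * j + 1) * card (fst ` XR) \<le> (3 * j + 1) * card (fst ` X)"
    by (metis add_mult_distrib2 mult_le_mono2)
  moreover have "card (labels h XL) + card (labels h XR) \<le> card (labels h X)"
    using fin sub Suc.prems(1)
    by (subst card_Un_disjoint[symmetric]) (fastforce simp: labels_def intro!: card_mono)+
  then have "j * card (labels h XL) + j * card (labels h XR) \<le> j * card (labels h X)"
    by (metis add_mult_distrib2 mult_le_mono2)
  ultimately show ?case using card_X by (simp add: algebra_simps)
qed

text \<open>The lower threshold \<open>2 * k\<close> is chosen so that each label accounts for at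
  least \<open>2 * k\<close> pairs. The label term of \<open>card_dyadic_le\<close> is then at most
  half of the left-hand side and can be absorbed.\<close>

lemma card_medium_le:
  assumes B: "B \<subseteq> {..<M}" and K: "K = 2 ^ k" and k: "0 < k"
  shows "card {(b, i). b \<in> B \<and> i < K \<and> 2 * k \<le> card {b' \<in> B. h (b', i) = h (b, i)} \<and>
    card {b' \<in> B. h (b', i) = h (b, i)} \<le> T} \<le> 2 * (3 * k + 1) * card B" (is "card ?X \<le> _")
proof -
  have finB: "finite B" using B finite_subset by blast
  have finX: "finite ?X" by (rule finite_subset[of _ "B \<times> {..<K}"]) (use finB in auto)
  \<comment> \<open>Being medium is a property of the whole class within \<open>B\<close>, so
    \<open>?X\<close> contains a class entirely or not at all.\<close>
  have cls: "{b'. (b', i) \<in> ?X \<and> h (b', i) = h (b, i)} = {b' \<in> B. h (b', i) = h (b, i)}"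
    if "(b, i) \<in> ?X" for b i using that by auto
  have "card ?X \<le> (3 * k + 1) * card (fst ` ?X) + k * card (labels h ?X)"
  proof (rule card_dyadic_le[of _ 0])
    show "multiplicity_le T h ?X"
      unfolding multiplicity_le_def
    proof clarify
      fix b i assume *: "b \<in> B" "i < K" "2 * k \<le> card {b' \<in> B. h (b', i) = h (b, i)}"
        "card {b' \<in> B. h (b', i) = h (b, i)} \<le> T"
      then have "(b, i) \<in> ?X" by blast
      from cls[OF this] *(4) show "card {b'. (b', i) \<in> ?X \<and> h (b', i) = h (b, i)} \<le> T" by simp
    qed
  qed (use finX B K in auto)
  moreover have "(3 * k + 1) * card (fst ` ?X) \<le> (3 * k + 1) * card B"
    using finB by (intro mult_left_mono card_mono) auto
  moreover have "2 * k * card (labels h ?X) \<le> card ?X"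
  proof -
    have "(\<Sum>p\<in>labels h ?X. 2 * k) \<le> (\<Sum>p\<in>labels h ?X. \<Sum>x\<in>{x \<in> ?X. (\<lambda>(b, i). (i, h (b, i))) x = p}. 1)"
    proof (rule sum_mono)
      fix p assume "p \<in> labels h ?X"
      then obtain b i where bi: "(b, i) \<in> ?X" and p: "p = (i, h (b, i))"
        by (auto simp: labels_def)
      have "{x \<in> ?X. (\<lambda>(b, i). (i, h (b, i))) x = p} = (\<lambda>b'. (b', i)) ` {b' \<in> B. h (b', i) = h (b, i)}"
        using bi by (auto simp: p)
      moreover have "2 * k \<le> card {b' \<in> B. h (b', i) = h (b, i)}" using bi by auto
      ultimately show "2 * k \<le> (\<Sum>x\<in>{x \<in> ?X. (\<lambda>(b, i). (i, h (b, i))) x = p}. 1)"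
        by (simp add: card_image inj_on_def)
    qed
    also have "\<dots> = card ?X"
      unfolding labels_def by (subst sum.image_gen[OF finX, symmetric]) simp
    finally show ?thesis by (simp add: mult.commute)
  qed
  ultimately show ?thesis by (simp add: algebra_simps)
qed

end

section \<open>Choice of the parameters\<close>

text \<open>The average class size \<open>M / N i\<close> is \<open>Q ^ (3 ^ i)\<close>. The union
  bound needs \<open>N j\<close> squared to exceed \<open>M * N (Suc j)\<close> by the factor
  \<open>c\<close>, which holds as these exponents more than double from level to level. The last
  conclusion makes room for \<open>q\<close> private vertices per class without outnumbering the
  \<open>M\<close> vertices.\<close>

lemma exists_sparse_map_instance:
  assumes K: "0 < K"
  obtains M N h where "sparse_map M K T N h" "0 < M" "q * (\<Sum>i<K. N i) \<le> M"
proof -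
  define c where "c = 16 * K * 2 ^ K * (T * K)"
  define Q where "Q = c + q * K + 1"
  define M where "M = Q ^ (3 ^ K)"
  define N where "N = (\<lambda>i. Q ^ (3 ^ K - 3 ^ i))"
  \<comment> \<open>\<open>n (Suc l) = N l\<close>; the value at \<open>0\<close> is immaterial, it only has to be large\<close>
  define n where "n = case_nat (c * M * N 0 + 1) N"
  have Q: "0 < Q" "c \<le> Q" "q * K \<le> Q" by (auto simp: Q_def)
  have antimono: "N j \<le> N i" if "i \<le> j" for i j
    unfolding N_def using Q that by (intro power_increasing diff_le_mono2) auto
  have small: "16 * K * 2 ^ K * M * (T * K * N l) \<le> (n l)\<^sup>2" if l: "l < K" for l
  proof (cases l)
    case 0
    have "16 * K * 2 ^ K * M * (T * K * N l) \<le> n l" by (simp add: 0 n_def c_def)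
    also have "\<dots> \<le> (n l)\<^sup>2" by (rule self_le_power) (simp_all add: 0 n_def)
    finally show ?thesis .
  next
    case (Suc j)
    have le: "(3 :: nat) ^ Suc j \<le> 3 ^ K" using l Suc by (intro power_increasing) auto
    \<comment> \<open>The exponents of the two sides differ by
      \<open>3 ^ Suc j - 2 * 3 ^ j = 3 ^ j\<close>, and this spare power of \<open>Q\<close> absorbs
      \<open>c\<close>.\<close>
    have "c \<le> Q ^ 3 ^ j" using Q self_le_power[of Q "3 ^ j"] by simp
    then have "c * (M * N l) \<le> Q ^ 3 ^ j * (M * N l)" by (rule mult_right_mono) simp
    also have "\<dots> = Q ^ (3 ^ j + (3 ^ K + (3 ^ K - 3 ^ Suc j)))"
      by (simp only: M_def N_def Suc power_add)
    also have "3 ^ j + (3 ^ K + (3 ^ K - 3 ^ Suc j)) = (3 ^ K - 3 ^ j) * (2 :: nat)"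
      using le by (simp add: algebra_simps)
    also have "Q ^ \<dots> = (n l)\<^sup>2" by (simp add: n_def Suc N_def power_mult)
    finally show ?thesis by (simp add: c_def algebra_simps)
  qed
  have n_le: "n l \<le> N i" if "i < l" "l < K" for l i
    using that by (cases l) (auto simp: n_def intro!: antimono)
  have N_pos: "0 < N i" for i using Q by (simp add: N_def)
  have n_pos: "0 < n l" for l using N_pos by (cases l) (auto simp: n_def)
  obtain h where "\<And>b i. b < M \<Longrightarrow> i < K \<Longrightarrow> h (b, i) < N i"
    and "\<And>l X. l < K \<Longrightarrow> X \<noteq> {} \<Longrightarrow> X \<subseteq> {..<M} \<times> {..<l} \<Longrightarrow> card (fst ` X) \<le> T * K * N l \<Longrightarrow>
      repeats h X \<Longrightarrow> \<exists>b\<in>fst ` X. card {i. (b, i) \<in> X} < 4"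
    using exists_sparse_map[of K n N M "\<lambda>l. T * K * N l"] K n_le n_pos N_pos small by metis
  then have "sparse_map M K T N h" using antimono by unfold_locales
  moreover have "0 < M" using Q by (simp add: M_def)
  moreover have "q * (\<Sum>i<K. N i) \<le> M"
  proof -
    have "q * (\<Sum>i<K. N i) \<le> q * (\<Sum>i<K. N 0)"
      by (intro mult_left_mono sum_mono antimono) auto
    also have "\<dots> = (q * K) * N 0" by simp
    also have "\<dots> \<le> Q * N 0" using Q by (intro mult_right_mono) auto
    also have "\<dots> = Q ^ (1 + (3 ^ K - 1))" by (simp only: N_def power_add power_0 power_one_right)
    also have "1 + (3 ^ K - 1) = (3 :: nat) ^ K" by simp
    also have "Q ^ \<dots> = M" by (simp add: M_def)
    finally show ?thesis .
  qed
  ultimately show thesis by (rule that)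
qed

section \<open>The graph\<close>

text \<open>For the edge relation of a bipartite graph, a rectangle is exactly a 4-cycle.\<close>

definition rectangle_free :: "('a \<times> 'b) set \<Rightarrow> bool" where
  "rectangle_free F \<longleftrightarrow> (\<forall>a a' b b'. (a, b) \<in> F \<longrightarrow> (a, b') \<in> F \<longrightarrow> (a', b) \<in> F \<longrightarrow> (a', b') \<in> F \<longrightarrow>
    a = a' \<or> b = b')"

text \<open>An ordered pair of distinct elements of \<open>A\<close> has at most one common
  neighbour in \<open>B\<close>, so the sets of pairs of neighbours of different \<open>b\<close>
  are disjoint.\<close>

lemma rectangle_free_degrees:
  assumes "finite A" "finite B" "F \<subseteq> B \<times> A" "rectangle_free F"
  defines "d \<equiv> \<lambda>b. card {a. (b, a) \<in> F}"
  shows "card F = (\<Sum>b\<in>B. d b)" "(\<Sum>b\<in>B. d b * (d b - 1)) \<le> card A * card A"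
proof -
  have fin: "finite {a. (b, a) \<in> F}" for b
    by (rule finite_subset[OF _ assms(1)]) (use assms(3) in auto)
  have "F = (SIGMA b:B. {a. (b, a) \<in> F})" using assms(3) by auto
  then show "card F = (\<Sum>b\<in>B. d b)"
    unfolding d_def using card_SigmaI[OF assms(2), of "\<lambda>b. {a. (b, a) \<in> F}"] fin by metis
  define P where "P = (\<lambda>b. {a. (b, a) \<in> F} \<times> {a. (b, a) \<in> F} - (\<lambda>a. (a, a)) ` {a. (b, a) \<in> F})"
  have finP: "finite (P b)" for b using fin by (simp add: P_def)
  have "card (P b) = d b * (d b - 1)" for b
  proof -
    have "card (P b) = d b * d b - card ((\<lambda>a. (a, a)) ` {a. (b, a) \<in> F})"
      unfolding P_def d_def using fin
      by (subst card_Diff_subset) (auto simp: card_cartesian_product)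
    also have "card ((\<lambda>a. (a, a)) ` {a. (b, a) \<in> F}) = d b"
      by (simp add: d_def card_image inj_on_def)
    finally show ?thesis by (simp add: right_diff_distrib')
  qed
  then have "(\<Sum>b\<in>B. d b * (d b - 1)) = (\<Sum>b\<in>B. card (P b))" by simp
  also have "\<dots> = card (\<Union>b\<in>B. P b)"
  proof (rule card_UN_disjoint[symmetric])
    show "\<forall>b\<in>B. \<forall>b'\<in>B. b \<noteq> b' \<longrightarrow> P b \<inter> P b' = {}"
      using assms(4) unfolding rectangle_free_def P_def by blast
  qed (use assms(2) finP in auto)
  also have "\<dots> \<le> card (A \<times> A)"
    using assms(1,3) by (intro card_mono) (auto simp: P_def)
  finally show "(\<Sum>b\<in>B. d b * (d b - 1)) \<le> card A * card A" by (simp add: card_cartesian_product)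
qed

text \<open>Both bounds compare the degree \<open>d\<close> with \<open>d * (d - 1)\<close> vertex
  by vertex: \<open>d\<close> is at most \<open>1 + d * (d - 1)\<close>, and either
  \<open>d \<le> t + 1\<close> or \<open>t \<le> d - 1\<close>.\<close>

lemma card_rectangle_free_le:
  assumes "finite A" "finite B" "F \<subseteq> B \<times> A" "rectangle_free F"
  shows "card F \<le> card B + card A * card A"
    and "t * card F \<le> t * (t + 1) * card B + card A * card A"
proof -
  define d where "d = (\<lambda>b. card {a. (b, a) \<in> F})"
  have deg: "card F = (\<Sum>b\<in>B. d b)" "(\<Sum>b\<in>B. d b * (d b - 1)) \<le> card A * card A"
    using rectangle_free_degrees[OF assms] by (simp_all only: d_def)
  have "card F \<le> (\<Sum>b\<in>B. 1 + d b * (d b - 1))"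
    unfolding deg(1)
  proof (rule sum_mono)
    fix b
    have "n \<le> 1 + n * (n - 1)" for n :: nat by (cases n; cases "n - 1") auto
    then show "d b \<le> 1 + d b * (d b - 1)" .
  qed
  also have "\<dots> = card B + (\<Sum>b\<in>B. d b * (d b - 1))" by (simp only: sum.distrib card_eq_sum)
  finally show "card F \<le> card B + card A * card A" using deg(2) by linarith
  have "t * card F \<le> (\<Sum>b\<in>B. t * (t + 1) + d b * (d b - 1))"
    unfolding deg(1) sum_distrib_left
  proof (rule sum_mono)
    fix b show "t * d b \<le> t * (t + 1) + d b * (d b - 1)"
    proof (cases "d b \<le> t + 1")
      case True
      then have "t * d b \<le> t * (t + 1)" by (rule mult_le_mono2)
      then show ?thesis by linarith
    next
      case False
      then have "t * d b \<le> (d b - 1) * d b" by (intro mult_le_mono1) simp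
      also have "\<dots> = d b * (d b - 1)" by (rule mult.commute)
      finally show ?thesis by linarith
    qed
  qed
  then show "t * card F \<le> t * (t + 1) * card B + card A * card A"
    using deg(2) by (simp add: sum.distrib mult.commute)
qed

section \<open>The graph and its \<open>C\<^sub>4\<close>-free subgraphs\<close>

definition vertex_B :: "nat \<Rightarrow> nat" where
  "vertex_B b = to_nat (Inl b :: nat + nat \<times> nat \<times> nat)"

text \<open>The triple \<open>(i, p, j)\<close> is the private vertex number \<open>j\<close> of
  class \<open>p\<close> in partition \<open>i\<close>. Both kinds of vertices are coded disjointly
  as natural numbers, the vertex type of the final theorem.\<close>

definition vertex_A :: "nat \<times> nat \<times> nat \<Rightarrow> nat" where
  "vertex_A x = to_nat (Inr x :: nat + nat \<times> nat \<times> nat)"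

lemma vertex_eq_iff [simp]:
  "vertex_B b = vertex_B b' \<longleftrightarrow> b = b'" "vertex_A x = vertex_A x' \<longleftrightarrow> x = x'"
  "vertex_A x \<noteq> vertex_B b" "vertex_B b \<noteq> vertex_A x"
  by (simp_all add: vertex_A_def vertex_B_def)

context sparse_map
begin

definition verts :: "nat \<Rightarrow> nat set" where
  "verts s = vertex_B ` {..<M} \<union> vertex_A ` (SIGMA i:{..<K}. {..<N i} \<times> {..<s})"

definition edges :: "nat \<Rightarrow> nat set set" where
  "edges s = (\<lambda>(b, i, j). {vertex_B b, vertex_A (i, h (b, i), j)}) ` ({..<M} \<times> {..<K} \<times> {..<s})"

lemma simple_graph: "simple_graph (verts s) (edges s)"
  unfolding simple_graph_def
proof
  show "edges s \<subseteq> {{u, v} | u v. u \<in> verts s \<and> v \<in> verts s \<and> u \<noteq> v}"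
  proof
    fix e assume "e \<in> edges s"
    then obtain b i j where e: "e = {vertex_B b, vertex_A (i, h (b, i), j)}"
      and *: "b < M" "i < K" "j < s" by (auto simp: edges_def)
    then have "vertex_B b \<in> verts s" "vertex_A (i, h (b, i), j) \<in> verts s"
      using h_less by (auto simp: verts_def)
    with e show "e \<in> {{u, v} | u v. u \<in> verts s \<and> v \<in> verts s \<and> u \<noteq> v}"
      by (metis (mono_tags, lifting) CollectI vertex_eq_iff(4))
  qed
qed (simp add: verts_def)

lemma card_edges: "card (edges s) = M * K * s"
proof -
  have "inj_on (\<lambda>(b, i, j). {vertex_B b, vertex_A (i, h (b, i), j)}) ({..<M} \<times> {..<K} \<times> {..<s})"
    by (auto simp: inj_on_def doubleton_eq_iff)
  then show ?thesis by (simp add: edges_def card_image card_cartesian_product)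
qed

lemma card_verts_le: "card (verts s) \<le> M + s * (\<Sum>i<K. N i)"
proof -
  have "card (verts s) \<le> card (vertex_B ` {..<M}) + card (vertex_A ` (SIGMA i:{..<K}. {..<N i} \<times> {..<s}))"
    unfolding verts_def by (rule card_Un_le)
  also have "\<dots> \<le> card {..<M} + card (SIGMA i:{..<K}. {..<N i} \<times> {..<s})"
    by (intro add_mono card_image_le) auto
  also have "\<dots> = M + s * (\<Sum>i<K. N i)"
    by (simp add: sum_distrib_left mult.commute)
  finally show ?thesis .
qed

lemma verts_nonempty: "0 < M \<Longrightarrow> 0 < card (verts s)"
  by (auto simp: verts_def card_gt_0_iff)

text \<open>The edges are counted class by class and charged to three sums: private vertices with
  weight \<open>t\<close>, all incidences of \<open>B\<close> with weight \<open>O(k)\<close>, and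
  medium incidences with weight \<open>O(t)\<close>. There are at most \<open>K\<close> incidences
  per vertex of \<open>B\<close>, and \<open>O(k)\<close> medium ones on average, so every vertex of
  \<open>V'\<close> is charged \<open>O(k * t)\<close>.\<close>

lemma card_C4_free_le:
  assumes K: "K = 2 ^ k" "K \<le> 2 * t" and k: "0 < k" and t: "0 < t" and T: "T = t ^ 4"
    and sub: "subgraph V' E' (verts (t\<^sup>2)) (edges (t\<^sup>2))" and C4: "C4_free V' E'"
  shows "card E' \<le> 24 * k * t * card V'"
proof -
  have finV': "finite V'" and E': "E' \<subseteq> edges (t\<^sup>2)"
    and pairs: "E' \<subseteq> {{u, v} | u v. u \<in> V' \<and> v \<in> V' \<and> u \<noteq> v}"
    using sub by (simp_all add: subgraph_def simple_graph_def)
  have E'V': "u \<in> V' \<and> v \<in> V'" if "{u, v} \<in> E'" for u v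
    using subsetD[OF pairs that] by (auto simp: doubleton_eq_iff)
  define B where "B = {b \<in> {..<M}. vertex_B b \<in> V'}"
  define A where "A = (\<lambda>i p. {j \<in> {..<t\<^sup>2}. vertex_A (i, p, j) \<in> V'})"
  define C where "C = (\<lambda>i p. {b \<in> B. h (b, i) = p})"
  define F where "F = (\<lambda>i p. {(b, j). b \<in> C i p \<and> j \<in> A i p \<and> {vertex_B b, vertex_A (i, p, j)} \<in> E'})"
  define Med where "Med = (\<lambda>i p. {b \<in> C i p. 2 * k \<le> card (C i p) \<and> card (C i p) \<le> T})"
  have finB: "finite B" by (simp add: B_def)
  have finA: "finite (A i p)" for i p by (simp add: A_def)
  have finC: "finite (C i p)" for i p using finB by (simp add: C_def)
  have finMed: "finite (Med i p)" for i p using finC by (simp add: Med_def)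
  have F_sub: "F i p \<subseteq> C i p \<times> A i p" for i p by (auto simp: F_def)
  have finF: "finite (F i p)" for i p using F_sub finC finA by (meson finite_SigmaI finite_subset)
  have rect: "rectangle_free (F i p)" for i p
    unfolding rectangle_free_def
  proof (intro allI impI, rule ccontr)
    fix b b' j j'
    assume *: "(b, j) \<in> F i p" "(b, j') \<in> F i p" "(b', j) \<in> F i p" "(b', j') \<in> F i p" "\<not> (b = b' \<or> j = j')"
    let ?a = "vertex_A (i, p, j)" and ?a' = "vertex_A (i, p, j')"
    have e: "{vertex_B b, ?a} \<in> E'" "{?a, vertex_B b'} \<in> E'" "{vertex_B b', ?a'} \<in> E'" "{?a', vertex_B b} \<in> E'"
      using * by (auto simp: F_def insert_commute)
    moreover have "distinct [vertex_B b, ?a, vertex_B b', ?a']" using *(5) by auto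
    moreover have "vertex_B b \<in> V'" "?a \<in> V'" "vertex_B b' \<in> V'" "?a' \<in> V'"
      using E'V'[OF e(1)] E'V'[OF e(3)] by simp_all
    ultimately have "has_C4 V' E'"
      unfolding has_C4_def by (intro exI[of _ "vertex_B b"] exI[of _ ?a] exI[of _ "vertex_B b'"] exI[of _ ?a'] conjI)
    then show False using C4 by (simp add: C4_free_def)
  qed
  have "E' \<subseteq> (\<Union>i<K. \<Union>p<N i. (\<lambda>(b, j). {vertex_B b, vertex_A (i, p, j)}) ` F i p)"
  proof
    fix e assume e: "e \<in> E'"
    then obtain b i j where e_eq: "e = {vertex_B b, vertex_A (i, h (b, i), j)}"
      and *: "b < M" "i < K" "j < t\<^sup>2" using E' by (auto simp: edges_def)
    have "vertex_B b \<in> V'" "vertex_A (i, h (b, i), j) \<in> V'" using E'V' e unfolding e_eq by blast+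
    then have "(b, j) \<in> F i (h (b, i))"
      using * e unfolding e_eq F_def C_def A_def B_def by simp
    show "e \<in> (\<Union>i<K. \<Union>p<N i. (\<lambda>(b, j). {vertex_B b, vertex_A (i, p, j)}) ` F i p)"
    proof (intro UN_I)
      show "i \<in> {..<K}" "h (b, i) \<in> {..<N i}" using * h_less by simp_all
      show "e \<in> (\<lambda>(b', j). {vertex_B b', vertex_A (i, h (b, i), j)}) ` F i (h (b, i))"
        using \<open>(b, j) \<in> F i (h (b, i))\<close> unfolding e_eq by (rule image_eqI[rotated]) simp
    qed
  qed
  then have "card E' \<le> card (\<Union>i<K. \<Union>p<N i. (\<lambda>(b, j). {vertex_B b, vertex_A (i, p, j)}) ` F i p)"
    by (rule card_mono[rotated]) (intro finite_UN_I finite_imageI finF finite_lessThan)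
  also have "\<dots> \<le> (\<Sum>i<K. card (\<Union>p<N i. (\<lambda>(b, j). {vertex_B b, vertex_A (i, p, j)}) ` F i p))"
    by (rule card_UN_le) simp
  also have "\<dots> \<le> (\<Sum>i<K. \<Sum>p<N i. card ((\<lambda>(b, j). {vertex_B b, vertex_A (i, p, j)}) ` F i p))"
    by (intro sum_mono card_UN_le) simp
  also have "\<dots> \<le> (\<Sum>i<K. \<Sum>p<N i. card (F i p))"
    by (intro sum_mono card_image_le finF)
  also have "\<dots> \<le> (\<Sum>i<K. \<Sum>p<N i. t * card (A i p) + (2 * k + 2) * card (C i p) + (t + 1) * card (Med i p))"
  proof (intro sum_mono)
    fix i p
    have cardA: "card (A i p) \<le> t\<^sup>2"
      using card_mono[of "{..<t\<^sup>2}" "A i p"] by (auto simp: A_def)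
    have rect': "rectangle_free ((F i p)\<inverse>)" using rect[of i p] by (auto simp: rectangle_free_def)
    consider "card (C i p) < 2 * k" | "2 * k \<le> card (C i p)" "card (C i p) \<le> T" | "T < card (C i p)"
      by linarith
    then show "card (F i p) \<le> t * card (A i p) + (2 * k + 2) * card (C i p) + (t + 1) * card (Med i p)"
    proof cases
      case 1
      \<comment> \<open>For a small class the roles are exchanged: the quadratic term falls on the
        class and is at most \<open>2 * k\<close> times its size.\<close>
      have "card (F i p) = card ((F i p)\<inverse>)" by simp
      also have "\<dots> \<le> card (A i p) + card (C i p) * card (C i p)"
        using F_sub by (intro card_rectangle_free_le(1) finA finC rect') auto
      also have "\<dots> \<le> t * card (A i p) + (2 * k + 2) * card (C i p)"
        using t 1 by (intro add_mono mult_right_mono) auto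
      finally show ?thesis by simp
    next
      case 2
      have "t * card (F i p) \<le> t * (t + 1) * card (C i p) + card (A i p) * card (A i p)"
        by (rule card_rectangle_free_le(2)[OF finA finC F_sub rect])
      also have "\<dots> \<le> t * (t + 1) * card (C i p) + t\<^sup>2 * card (A i p)"
        using cardA by simp
      also have "\<dots> = t * ((t + 1) * card (C i p) + t * card (A i p))"
        by (simp add: algebra_simps power2_eq_square)
      finally have "card (F i p) \<le> (t + 1) * card (C i p) + t * card (A i p)" using t by simp
      moreover have "Med i p = C i p" using 2 by (auto simp: Med_def)
      ultimately show ?thesis by simp
    next
      case 3
      have "card (F i p) \<le> card (C i p) + card (A i p) * card (A i p)"
        by (rule card_rectangle_free_le(1)[OF finA finC F_sub rect])
      \<comment> \<open>\<open>T\<close> is \<open>t ^ 4\<close> so that the quadratic term of the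
        private vertices is at most the size of a large class.\<close>
      also have "card (A i p) * card (A i p) \<le> t\<^sup>2 * t\<^sup>2" using cardA by (intro mult_mono) auto
      also have "\<dots> = T" by (simp add: T flip: power_add)
      finally show ?thesis using 3 by simp
    qed
  qed
  also have "\<dots> = t * (\<Sum>i<K. \<Sum>p<N i. card (A i p)) + (2 * k + 2) * (\<Sum>i<K. \<Sum>p<N i. card (C i p))
      + (t + 1) * (\<Sum>i<K. \<Sum>p<N i. card (Med i p))"
    by (simp only: sum.distrib sum_distrib_left)
  finally have main: "card E' \<le> \<dots>" .
  have Sigma_card: "(\<Sum>i<K. \<Sum>p<N i. card (S i p)) = card (SIGMA i:{..<K}. SIGMA p:{..<N i}. S i p)"
    if "\<And>i p. finite (S i p)" for S :: "nat \<Rightarrow> nat \<Rightarrow> nat set"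
    using that by (subst card_SigmaI) (auto simp: card_SigmaI)
  have sumC: "(\<Sum>i<K. \<Sum>p<N i. card (C i p)) \<le> K * card B"
  proof -
    have "inj_on (\<lambda>(i, p, b). (i, b)) (SIGMA i:{..<K}. SIGMA p:{..<N i}. C i p)"
      by (rule inj_onI) (auto simp: C_def)
    moreover have "(\<lambda>(i, p, b). (i, b)) ` (SIGMA i:{..<K}. SIGMA p:{..<N i}. C i p) \<subseteq> {..<K} \<times> B"
      by (auto simp: C_def)
    moreover have "finite ({..<K} \<times> B)" using finB by simp
    ultimately have "card (SIGMA i:{..<K}. SIGMA p:{..<N i}. C i p) \<le> card ({..<K} \<times> B)"
      by (rule card_inj_on_le)
    also have "\<dots> = K * card B" by (simp add: card_cartesian_product)
    finally show ?thesis unfolding Sigma_card[OF finC] .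
  qed
  have sumMed: "(\<Sum>i<K. \<Sum>p<N i. card (Med i p)) \<le> 2 * (3 * k + 1) * card B"
  proof -
    let ?X = "{(b, i). b \<in> B \<and> i < K \<and> 2 * k \<le> card {b' \<in> B. h (b', i) = h (b, i)} \<and>
      card {b' \<in> B. h (b', i) = h (b, i)} \<le> T}"
    have "finite ?X" by (rule finite_subset[of _ "B \<times> {..<K}"]) (use finB in auto)
    moreover have "inj_on (\<lambda>(i, p, b). (b, i)) (SIGMA i:{..<K}. SIGMA p:{..<N i}. Med i p)"
      by (rule inj_onI) (auto simp: C_def Med_def)
    moreover have "(\<lambda>(i, p, b). (b, i)) ` (SIGMA i:{..<K}. SIGMA p:{..<N i}. Med i p) \<subseteq> ?X"
      by (auto simp: C_def Med_def)
    ultimately have "card (SIGMA i:{..<K}. SIGMA p:{..<N i}. Med i p) \<le> card ?X"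
      by (intro card_inj_on_le)
    also have "\<dots> \<le> 2 * (3 * k + 1) * card B"
      by (rule card_medium_le[OF _ K(1) k]) (auto simp: B_def)
    finally show ?thesis unfolding Sigma_card[OF finMed] .
  qed
  have sumV: "(\<Sum>i<K. \<Sum>p<N i. card (A i p)) + card B \<le> card V'"
  proof -
    let ?S = "SIGMA i:{..<K}. SIGMA p:{..<N i}. A i p"
    have "card ?S + card B = card (vertex_A ` ?S) + card (vertex_B ` B)"
      by (simp add: card_image inj_on_def)
    also have "\<dots> = card (vertex_A ` ?S \<union> vertex_B ` B)"
      using finA finB by (intro card_Un_disjoint[symmetric]) auto
    also have "\<dots> \<le> card V'"
      using finV' by (intro card_mono) (auto simp: A_def B_def)
    finally show ?thesis unfolding Sigma_card[OF finA] .
  qed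
  let ?a = "\<Sum>i<K. \<Sum>p<N i. card (A i p)"
  have "card E' \<le> t * ?a + (2 * k + 2) * (K * card B) + (t + 1) * (2 * (3 * k + 1) * card B)"
    using main sumC sumMed by (meson add_mono mult_le_mono2 order.trans order.refl)
  \<comment> \<open>The rounding uses \<open>2 * k + 2 \<le> 4 * k\<close>,
    \<open>K \<le> 2 * t\<close>, \<open>t + 1 \<le> 2 * t\<close> and
    \<open>3 * k + 1 \<le> 4 * k\<close>. The two terms in \<open>card B\<close> add up to
    \<open>8 + 16 = 24\<close> times \<open>k * t\<close>.\<close>
  also have "\<dots> \<le> (24 * k * t) * ?a + (4 * k) * ((2 * t) * card B) + (2 * t) * (2 * (4 * k) * card B)"
    using K(2) k t by (intro add_mono mult_mono) auto
  also have "\<dots> = (24 * k * t) * (?a + card B)" by (simp add: algebra_simps)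
  also have "\<dots> \<le> (24 * k * t) * card V'" using sumV by (rule mult_le_mono2)
  finally show ?thesis .
qed

end

section \<open>The logarithmic scale and the conclusion\<close>

text \<open>The least \<open>k\<close> with \<open>t \<le> 2 ^ k\<close> satisfies
  \<open>2 ^ (k - 1) < t\<close>, hence \<open>k * ln 2\<close> is at most
  \<open>ln t + ln 2\<close>, thus at most \<open>2 * ln t\<close>. Then
  \<open>ln 2 \<ge> 1 / 2\<close> gives the factor 4.\<close>

lemma dyadic_scale:
  fixes t :: nat
  assumes "2 \<le> t"
  obtains k where "0 < k" "t \<le> 2 ^ k" "2 ^ k \<le> 2 * t" "real k \<le> 4 * ln (real t)"
proof -
  define k where "k = (LEAST k. t \<le> 2 ^ k)"
  have "t \<le> 2 ^ t" by (simp add: less_imp_le)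
  then have k: "t \<le> 2 ^ k" unfolding k_def by (rule LeastI)
  then have "0 < k" using assms by (cases k) auto
  then obtain j where j: "k = Suc j" by (cases k) auto
  then have less: "2 ^ j < t" unfolding k_def by (metis lessI not_less not_less_Least)
  have "real j * ln 2 = ln (real (2 ^ j))" by (simp add: ln_realpow)
  also have "\<dots> \<le> ln (real t)" using less assms by (subst ln_le_cancel_iff) (auto simp del: of_nat_power)
  finally have "real j * ln 2 \<le> ln (real t)" .
  moreover have "ln 2 \<le> ln (real t)" using assms by simp
  ultimately have "real k * ln 2 \<le> 2 * ln (real t)" by (simp add: j algebra_simps)
  moreover have "1 / 2 \<le> ln (2 :: real)"
  proof -
    have "exp 1 \<le> (2 :: real) ^ 2" using exp_le by simp
    then have "1 \<le> ln ((2 :: real) ^ 2)" by (subst ln_ge_iff) simp_all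
    also have "\<dots> = 2 * ln 2" using ln_realpow[of "2 :: real" 2] by simp
    finally show ?thesis by simp
  qed
  then have "real k * (1 / 2) \<le> real k * ln 2" by (rule mult_left_mono) simp
  ultimately have "real k \<le> 4 * ln (real t)" by simp
  with \<open>0 < k\<close> k less show thesis by (intro that[of k]) (auto simp: j)
qed

theorem theorem2:
  shows "\<exists>c::real. \<forall>t::nat. t \<ge> 2 \<longrightarrow>
    (\<exists>(V::nat set) E. simple_graph V E \<and> avg_degree V E \<ge> real t ^ 3 \<and>
       (\<forall>V' E'. subgraph V' E' V E \<and> C4_free V' E' \<longrightarrow>
          avg_degree V' E' < c * real t * ln (real t)))"
proof (rule exI[of _ 193], intro allI impI)
  fix t :: nat assume t: "2 \<le> t"
  obtain k where k: "0 < k" "t \<le> 2 ^ k" "2 ^ k \<le> 2 * t" "real k \<le> 4 * ln (real t)"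
    using dyadic_scale[OF t] .
  define K :: nat where "K = 2 ^ k"
  obtain M N h where "sparse_map M K (t ^ 4) N h" and M: "0 < M" "t\<^sup>2 * (\<Sum>i<K. N i) \<le> M"
    by (rule exists_sparse_map_instance[of K "t ^ 4" "t\<^sup>2"]) (auto simp: K_def)
  then interpret sparse_map M K "t ^ 4" N h by simp
  have ln_pos: "0 < ln (real t)" using t by simp
  have "real t ^ 3 \<le> avg_degree (verts (t\<^sup>2)) (edges (t\<^sup>2))"
  proof -
    \<comment> \<open>The private vertices number at most \<open>M\<close>, so the average degree is
      at least the common degree \<open>K * t\<^sup>2\<close> of the \<open>M\<close>
      vertices.\<close>
    have "card (verts (t\<^sup>2)) \<le> 2 * M" using card_verts_le[of "t\<^sup>2"] M(2) by linarith
    then have "t ^ 3 * card (verts (t\<^sup>2)) \<le> t ^ 3 * (2 * M)" by (rule mult_le_mono2)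
    also have "\<dots> = 2 * (M * t * t\<^sup>2)" by (simp add: power3_eq_cube power2_eq_square)
    also have "\<dots> \<le> 2 * (M * K * t\<^sup>2)" using k(2) by (simp add: K_def)
    also have "\<dots> = 2 * card (edges (t\<^sup>2))" by (simp only: card_edges)
    finally have "real (t ^ 3 * card (verts (t\<^sup>2))) \<le> real (2 * card (edges (t\<^sup>2)))"
      by (rule of_nat_mono)
    then show ?thesis using verts_nonempty[OF M(1), of "t\<^sup>2"] by (simp add: avg_degree_def pos_le_divide_eq)
  qed
  moreover have "avg_degree V' E' < 193 * real t * ln (real t)"
    if "subgraph V' E' (verts (t\<^sup>2)) (edges (t\<^sup>2))" "C4_free V' E'" for V' E'
  proof -
    have "card E' \<le> 24 * k * t * card V'"
      using k t that by (intro card_C4_free_le) (auto simp: K_def)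
    then have "real (card E') \<le> real (24 * k * t * card V')" by (rule of_nat_mono)
    then have "avg_degree V' E' \<le> 48 * real k * real t"
      \<comment> \<open>For an empty vertex set the average degree is 0, by the convention for
        division by zero.\<close>
      by (cases "card V' = 0") (simp_all add: avg_degree_def divide_le_eq)
    also have "\<dots> \<le> 48 * (4 * ln (real t)) * real t" using k(4) by (intro mult_mono) auto
    \<comment> \<open>\<open>48 * 4\<close> is 192; the constant 193 makes the inequality strict, as
      \<open>t * ln t\<close> is positive.\<close>
    also have "\<dots> < 193 * real t * ln (real t)" using t ln_pos by simp
    finally show ?thesis .
  qed
  ultimately show "\<exists>(V::nat set) E. simple_graph V E \<and> avg_degree V E \<ge> real t ^ 3 \<and>
       (\<forall>V' E'. subgraph V' E' V E \<and> C4_free V' E' \<longrightarrow>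
          avg_degree V' E' < 193 * real t * ln (real t))"
    using simple_graph by blast
qed

end
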